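(* For every integer $m\ge1$ let $C(m)=\frac{1}{m!}\int_0^\pi \frac{\theta^{m}}{2}\cot\left(\frac{\theta}{2}\right)d\theta$. For $l\ge0$ define $$S_1(l)=\sum_{j_0=0}^\infty \binom{2j_0}{j_0}\left(\frac12\right)^{2j_0}\frac{1}{(2j_0+1)^2}\sum_{j_1=j_0}^\infty\sum_{j_2=j_1}^\infty\cdots\sum_{j_l=j_{l-1}}^\infty \frac{1}{(2j_1+1)^2(2j_2+1)^2\cdots(2j_l+1)^2},$$ $$S_0(l)=\frac12\sum_{j_0=1}^\infty \frac{2^{2j_0}}{\binom{2j_0}{j_0}}\frac{1}{j_0^3}\sum_{j_1=j_0}^\infty\sum_{j_2=j_1}^\infty\cdots\sum_{j_l=j_{l-1}}^\infty \frac{1}{j_1^2j_2^2\cdots j_l^2},$$ (for $l=0$ there are no inner sums). Then for every integer $k\ge0$, $$C(2k+1)=\sum_{l=0}^k(-1)^l\frac{2^{2l+1}\pi^{2k-2l}}{(2k-2l)!}S_1(l),\qquad C(2k+2)=\sum_{l=0}^k(-1)^l\frac{\pi^{2k-2l}}{(2k-2l+1)!}S_0(l).$$ *)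

theory Defs
  imports "HOL-Analysis.Analysis"
begin

text \<open>
  At \<open>\<theta> = 0\<close> the integrand takes the junk value \<open>0\<close>
  (\<open>cot 0 = 0\<close>); a single point does not affect the integral. The definition is
  meant for \<open>m \<ge> 1\<close>, where the integrand is bounded.
\<close>

definition cot_integral :: "nat \<Rightarrow> real" where
  "cot_integral m = 1 / fact m * integral {0..pi} (\<lambda>\<theta>. \<theta> ^ m / 2 * cot (\<theta> / 2))"

definition sum_from :: "nat \<Rightarrow> (nat \<Rightarrow> real) \<Rightarrow> real" where
  "sum_from n f = (\<Sum>i. f (n + i))"

text \<open>
  \<open>nested_sum l n f\<close> is the iterated series
  \<open>\<Sum>j\<^sub>1\<ge>n. \<Sum>j\<^sub>2\<ge>j\<^sub>1. \<dots> \<Sum>j\<^sub>l\<ge>j\<^sub>l\<^sub>-\<^sub>1. f [j\<^sub>1, \<dots>, j\<^sub>l]\<close>,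
  which is \<open>f []\<close> when \<open>l = 0\<close>.
\<close>

primrec nested_sum :: "nat \<Rightarrow> nat \<Rightarrow> (nat list \<Rightarrow> real) \<Rightarrow> real" where
  "nested_sum 0 n f = f []"
| "nested_sum (Suc l) n f = sum_from n (\<lambda>j. nested_sum l j (\<lambda>js. f (j # js)))"

definition S1 :: "nat \<Rightarrow> real" where
  "S1 l = sum_from 0 (\<lambda>j0. real ((2 * j0) choose j0) * (1 / 2) ^ (2 * j0) * (1 / (2 * real j0 + 1)\<^sup>2) *
            nested_sum l j0 (\<lambda>js. 1 / (\<Prod>j\<leftarrow>js. (2 * real j + 1)\<^sup>2)))"

definition S0 :: "nat \<Rightarrow> real" where
  "S0 l = 1 / 2 * sum_from 1 (\<lambda>j0. 2 ^ (2 * j0) / real ((2 * j0) choose j0) * (1 / real j0 ^ 3) *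
            nested_sum l j0 (\<lambda>js. 1 / (\<Prod>j\<leftarrow>js. (real j)\<^sup>2)))"

end

theory Submission
  imports Defs
begin

text \<open>
  Substituting \<open>\<theta> = 2 u\<close> turns \<open>cot_integral m\<close> into \<open>2 ^ m\<close> times the integral of
  \<open>u ^ m / m! * cot u\<close> over \<open>[0, \<pi>/2]\<close>. Expanding \<open>u ^ m / m!\<close> as a power series in \<open>sin u\<close>
  (the series of \<open>arcsin ^ m / m!\<close>, with nonnegative coefficients) and integrating termwise gives
  a single series. For \<open>m = 2 k + 1 + q\<close> with \<open>q \<in> {0, 1}\<close>, its coefficients are those for \<open>k = 0\<close>
  times the elementary symmetric functions \<open>e\<^sub>k\<close> of the numbers \<open>1 / (2 i + 1 + q)\<^sup>2\<close>, \<open>i < j\<close>. These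
  are alternating combinations of the complete homogeneous symmetric functions of the
  remaining numbers, \<open>i \<ge> j\<close>, which are the nested sums; the weights are the limits of the
  \<open>e\<^sub>k\<close>. An Abelian argument at \<open>u \<rightarrow> \<pi>/2\<close>, applied to the differentiated series,
  evaluates the limits as \<open>(\<pi>/2) ^ (2 k) / (2 k + q)!\<close>.
\<close>

section \<open>Taylor coefficients and power series of the powers of arcsin\<close>

text \<open>The coefficient of \<open>x ^ n\<close> in y_m = arcsin(x)^m / m!. The recursion
  compares coefficients in (1 - x^2) y_m'' - x y_m' = y_(m-2), with right-hand side 0 for m = 1;
  that case is split off because truncated subtraction would turn y_(-1) into y_0.\<close>

fun arcsin_coeff :: "nat \<Rightarrow> nat \<Rightarrow> real" where
  "arcsin_coeff 0 n = (if n = 0 then 1 else 0)"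
| "arcsin_coeff (Suc m) 0 = 0"
| "arcsin_coeff (Suc m) (Suc 0) = (if m = 0 then 1 else 0)"
| "arcsin_coeff (Suc m) (Suc (Suc n)) =
     (real n ^ 2 * arcsin_coeff (Suc m) n + (if m = 0 then 0 else arcsin_coeff (m - 1) n))
       / ((real n + 1) * (real n + 2))"

lemma arcsin_coeff_rec:
  assumes "m > 0"
  shows "(real n + 1) * (real n + 2) * arcsin_coeff m (n + 2) =
    real n ^ 2 * arcsin_coeff m n + (if m = 1 then 0 else arcsin_coeff (m - 2) n)"
proof -
  obtain m' where "m = Suc m'" using assms by (cases m) auto
  moreover have "(real n + 1) * (real n + 2) \<noteq> 0"
    by (simp add: add_eq_0_iff_both_eq_0 add_nonneg_pos)
  ultimately show ?thesis
    by (simp del: mult_eq_0_iff add: numeral_2_eq_2)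
qed

lemma arcsin_coeff_nonneg: "arcsin_coeff m n \<ge> 0"
  by (induction m n rule: arcsin_coeff.induct) auto

text \<open>Crude, but enough for comparison with the geometric series. The induction works because
  n^2 + 1 \<le> (n + 1)(n + 2).\<close>

lemma arcsin_coeff_le_1: "arcsin_coeff m n \<le> 1"
proof (induction m n rule: arcsin_coeff.induct)
  case (4 m n)
  have "real n ^ 2 * arcsin_coeff (Suc m) n + (if m = 0 then 0 else arcsin_coeff (m - 1) n)
      \<le> real n ^ 2 * 1 + 1"
    using 4 by (intro add_mono mult_left_mono) auto
  also have "\<dots> \<le> (real n + 1) * (real n + 2)"
    by (simp add: algebra_simps power2_eq_square)
  finally show ?case by simp
qed auto

lemma arcsin_coeff_parity: "odd (m + n) \<Longrightarrow> arcsin_coeff m n = 0"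
  by (induction m n rule: arcsin_coeff.induct) (auto intro: odd_pos)

declare arcsin_coeff.simps(4) [simp del]

lemma summable_arcsin_coeff:
  fixes x :: real
  assumes "\<bar>x\<bar> < 1"
  shows "summable (\<lambda>n. arcsin_coeff m n * x ^ n)"
proof (rule summable_comparison_test')
  show "summable (\<lambda>n. \<bar>x\<bar> ^ n)" using assms by simp
  show "norm (arcsin_coeff m n * x ^ n) \<le> \<bar>x\<bar> ^ n" if "n \<ge> 0" for n
    using arcsin_coeff_nonneg[of m n] arcsin_coeff_le_1[of m n]
    by (simp add: abs_mult power_abs mult_left_le_one_le)
qed

definition arcsin_powser :: "nat \<Rightarrow> real \<Rightarrow> real" where
  "arcsin_powser m x = (\<Sum>n. arcsin_coeff m n * x ^ n)"

definition arcsin_powser' :: "nat \<Rightarrow> real \<Rightarrow> real" where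
  "arcsin_powser' m x = (\<Sum>n. diffs (arcsin_coeff m) n * x ^ n)"

definition arcsin_powser'' :: "nat \<Rightarrow> real \<Rightarrow> real" where
  "arcsin_powser'' m x = (\<Sum>n. diffs (diffs (arcsin_coeff m)) n * x ^ n)"

lemma summable_arcsin_coeff':
  fixes x :: real
  assumes "\<bar>x\<bar> < 1"
  shows "summable (\<lambda>n. diffs (arcsin_coeff m) n * x ^ n)"
  by (rule termdiff_converges[of x 1]) (use assms summable_arcsin_coeff in auto)

lemma summable_arcsin_coeff'':
  fixes x :: real
  assumes "\<bar>x\<bar> < 1"
  shows "summable (\<lambda>n. diffs (diffs (arcsin_coeff m)) n * x ^ n)"
  by (rule termdiff_converges[of x 1]) (use assms summable_arcsin_coeff' in auto)

lemma arcsin_powser_deriv: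
  assumes "\<bar>x\<bar> < 1"
  shows "(arcsin_powser m has_real_derivative arcsin_powser' m x) (at x)"
  unfolding arcsin_powser_def[abs_def] arcsin_powser'_def
  by (rule termdiffs_strong'[of 1]) (use assms summable_arcsin_coeff in auto)

lemma arcsin_powser'_deriv:
  assumes "\<bar>x\<bar> < 1"
  shows "(arcsin_powser' m has_real_derivative arcsin_powser'' m x) (at x)"
  unfolding arcsin_powser'_def[abs_def] arcsin_powser''_def
  by (rule termdiffs_strong'[of 1]) (use assms summable_arcsin_coeff' in auto)

lemma arcsin_powser_0: "arcsin_powser m 0 = arcsin_coeff m 0"
  unfolding arcsin_powser_def by (rule powser_zero)

lemma arcsin_powser'_0: "arcsin_powser' m 0 = arcsin_coeff m 1"
  unfolding arcsin_powser'_def powser_zero by (simp add: diffs_def)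

text \<open>Under \<open>x = sin u\<close> the left-hand side is the second derivative with respect to \<open>u\<close>.\<close>

lemma arcsin_powser_ode:
  assumes x: "\<bar>x\<bar> < 1" and m: "m > 0"
  shows "(1 - x\<^sup>2) * arcsin_powser'' m x - x * arcsin_powser' m x =
    (if m = 1 then 0 else arcsin_powser (m - 2) x)"
proof -
  let ?A = "arcsin_coeff m"
  let ?d1 = "\<lambda>n. real n * ?A n * x ^ n"
  let ?d2 = "\<lambda>n. real n * (real n - 1) * ?A n * x ^ n"
  let ?d3 = "\<lambda>n. (real n + 1) * (real n + 2) * ?A (n + 2) * x ^ n"
  have s1: "?d1 sums (x * arcsin_powser' m x)"
  proof -
    have "(\<lambda>n. x * (diffs ?A n * x ^ n)) sums (x * arcsin_powser' m x)"
      unfolding arcsin_powser'_def using summable_arcsin_coeff'[OF x]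
      by (intro sums_mult summable_sums)
    then have "(\<lambda>n. ?d1 (Suc n)) sums (x * arcsin_powser' m x)"
      by (simp add: diffs_def mult_ac)
    then show ?thesis by (subst (asm) sums_Suc_iff) simp
  qed
  have s3: "?d3 sums arcsin_powser'' m x"
    unfolding arcsin_powser''_def using summable_sums[OF summable_arcsin_coeff''[OF x], of m]
    by (simp add: diffs_def mult_ac add_ac)
  have s2: "?d2 sums (x\<^sup>2 * arcsin_powser'' m x)"
  proof -
    have "(\<lambda>n. x\<^sup>2 * ?d3 n) sums (x\<^sup>2 * arcsin_powser'' m x)"
      by (intro sums_mult s3)
    then have "(\<lambda>n. ?d2 (n + 2)) sums (x\<^sup>2 * arcsin_powser'' m x)"
      by (simp add: mult_ac power2_eq_square add_ac)
    moreover have "(\<Sum>i<2. ?d2 i) = 0" by (simp add: numeral_2_eq_2)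
    ultimately show ?thesis using sums_iff_shift'[of ?d2 2 "x\<^sup>2 * arcsin_powser'' m x"] by simp
  qed
  have "(\<lambda>n. ?d3 n - ?d2 n - ?d1 n) sums
      (arcsin_powser'' m x - x\<^sup>2 * arcsin_powser'' m x - x * arcsin_powser' m x)"
    by (intro sums_diff s1 s2 s3)
  moreover have "?d3 n - ?d2 n - ?d1 n =
      (if m = 1 then 0 else arcsin_coeff (m - 2) n * x ^ n)" for n
    unfolding arcsin_coeff_rec[OF m]
    by (simp add: algebra_simps power2_eq_square)
  ultimately have "(\<lambda>n. if m = 1 then 0 else arcsin_coeff (m - 2) n * x ^ n) sums
      ((1 - x\<^sup>2) * arcsin_powser'' m x - x * arcsin_powser' m x)"
    by (simp add: algebra_simps)
  then show ?thesis
    by (auto simp: arcsin_powser_def sums_iff split: if_splits)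
qed

section \<open>The substitution x = sin u\<close>

lemma sin_abs_less_1:
  assumes "\<bar>u\<bar> < pi / 2"
  shows "\<bar>sin u\<bar> < 1"
proof -
  have "cos u > 0" using assms by (intro cos_gt_zero_pi) auto
  then have "(sin u)\<^sup>2 < 1" using sin_cos_squared_add[of u] zero_less_power[of "cos u" 2] by linarith
  then show ?thesis by (simp add: abs_square_less_1)
qed

lemma eq_on_interval_if_deriv_eq:
  fixes f g f' :: "real \<Rightarrow> real"
  assumes f: "\<And>v. \<bar>v\<bar> < r \<Longrightarrow> (f has_real_derivative f' v) (at v)"
    and g: "\<And>v. \<bar>v\<bar> < r \<Longrightarrow> (g has_real_derivative f' v) (at v)"
    and "f 0 = g 0" and u: "\<bar>u\<bar> < r"
  shows "f u = g u"
proof -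
  let ?S = "{-r<..<r}"
  have "((\<lambda>v. f v - g v) has_real_derivative 0) (at v within ?S)" if "v \<in> ?S" for v
    using DERIV_diff[OF f g, of v] that by (auto intro: has_field_derivative_at_within)
  then obtain c where "\<And>v. v \<in> ?S \<Longrightarrow> f v - g v = c"
    using has_field_derivative_zero_constant[of ?S "\<lambda>v. f v - g v"] by auto
  then have "f u - g u = c" "f 0 - g 0 = c" using u by (auto simp: abs_less_iff)
  then show ?thesis using assms(3) by simp
qed

lemma power_fact_deriv:
  "((\<lambda>v::real. v ^ Suc m / fact (Suc m)) has_real_derivative u ^ m / fact m) (at u)"
proof -
  have "((\<lambda>v::real. v ^ Suc m / fact (Suc m)) has_real_derivative
      (real (Suc m) * u ^ m) / fact (Suc m)) (at u)"
    using DERIV_pow[of "Suc m" u UNIV] by (intro DERIV_cdivide) simp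
  then show ?thesis by (simp add: field_simps del: of_nat_Suc)
qed

text \<open>Strong induction in steps of two. By the differential equation, the second derivative in
  \<open>u\<close> of the left side is the left side for m - 2 (or 0 if m = 1). Values and first
  derivatives at 0 agree, so integrating twice gives equality.\<close>

lemma arcsin_powser_sin:
  assumes "\<bar>u\<bar> < pi / 2"
  shows "arcsin_powser m (sin u) = u ^ m / fact m"
  using assms
proof (induction m arbitrary: u rule: less_induct)
  case (less m)
  show ?case
  proof (cases "m = 0")
    case True
    have "(\<lambda>n. arcsin_coeff 0 n * sin u ^ n) sums (\<Sum>n\<in>{0}. arcsin_coeff 0 n * sin u ^ n)"
      by (rule sums_finite) auto
    then show ?thesis using True by (simp add: arcsin_powser_def sums_iff)
  next
    case False
    \<comment> \<open>The second derivative of \<open>v ^ m / fact m\<close>. For m = 1 truncated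
      subtraction would give 1 instead of 0.\<close>
    define r where "r = (\<lambda>v::real. if m = 1 then 0 else v ^ (m - 2) / fact (m - 2))"
    have deriv2: "((\<lambda>w. arcsin_powser' m (sin w) * cos w) has_real_derivative r v) (at v)"
      if v: "\<bar>v\<bar> < pi / 2" for v
    proof -
      have "((\<lambda>w. arcsin_powser' m (sin w) * cos w) has_real_derivative
          (arcsin_powser'' m (sin v) * cos v) * cos v + - sin v * arcsin_powser' m (sin v)) (at v)"
        by (intro DERIV_mult DERIV_chain2[OF arcsin_powser'_deriv] DERIV_sin DERIV_cos
            sin_abs_less_1 v)
      moreover have "(arcsin_powser'' m (sin v) * cos v) * cos v + - sin v * arcsin_powser' m (sin v)
          = (1 - (sin v)\<^sup>2) * arcsin_powser'' m (sin v) - sin v * arcsin_powser' m (sin v)"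
        unfolding cos_squared_eq[symmetric] by (simp add: power2_eq_square)
      moreover have "\<dots> = r v"
        using arcsin_powser_ode[OF sin_abs_less_1[OF v], of m] False less.IH[of "m - 2" v] v
        by (simp add: r_def)
      ultimately show ?thesis by simp
    qed
    have first: "arcsin_powser' m (sin v) * cos v = v ^ (m - 1) / fact (m - 1)"
      if v: "\<bar>v\<bar> < pi / 2" for v
    proof (rule eq_on_interval_if_deriv_eq[OF deriv2 _ _ v])
      show "((\<lambda>v. v ^ (m - 1) / fact (m - 1)) has_real_derivative r w) (at w)" for w
      proof (cases "m = 1")
        case m: False
        obtain m' where "m = Suc (Suc m')" using False m by (metis One_nat_def not0_implies_Suc)
        then show ?thesis using power_fact_deriv[of m' w] by (simp add: r_def)
      qed (simp add: r_def)
      show "arcsin_powser' m (sin 0) * cos 0 = 0 ^ (m - 1) / fact (m - 1)"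
        using False by (cases m) (auto simp: arcsin_powser'_0)
    qed
    show ?thesis
    proof (rule eq_on_interval_if_deriv_eq[OF _ _ _ less.prems])
      fix v :: real assume v: "\<bar>v\<bar> < pi / 2"
      show "((\<lambda>w. arcsin_powser m (sin w)) has_real_derivative v ^ (m - 1) / fact (m - 1)) (at v)"
        using DERIV_chain2[OF arcsin_powser_deriv[OF sin_abs_less_1[OF v]] DERIV_sin, of m]
        unfolding first[OF v] .
      show "((\<lambda>v. v ^ m / fact m) has_real_derivative v ^ (m - 1) / fact (m - 1)) (at v)"
        using power_fact_deriv[of "m - 1" v] False by simp
    next
      show "arcsin_powser m (sin 0) = 0 ^ m / fact m"
        using False by (cases m) (auto simp: arcsin_powser_0)
    qed
  qed
qed

lemma sums_power_fact:
  assumes "\<bar>u\<bar> < pi / 2"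
  shows "(\<lambda>n. arcsin_coeff m n * sin u ^ n) sums (u ^ m / fact m)"
  using summable_sums[OF summable_arcsin_coeff[OF sin_abs_less_1[OF assms]]]
    arcsin_powser_sin[OF assms] by (simp add: arcsin_powser_def)

text \<open>The derivative in \<open>u\<close> of \<open>sums_power_fact\<close>. It serves twice:
  as a majorant in the termwise integration, and for the limits of the elementary symmetric
  functions as u tends to pi/2.\<close>

lemma sums_power_fact_deriv:
  assumes u: "\<bar>u\<bar> < pi / 2" and m: "m > 0"
  shows "(\<lambda>n. real (Suc n) * arcsin_coeff m (Suc n) * sin u ^ n * cos u) sums
    (u ^ (m - 1) / fact (m - 1))"
proof -
  have "((\<lambda>w. arcsin_powser m (sin w)) has_real_derivative
      arcsin_powser' m (sin u) * cos u) (at u)"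
    by (intro DERIV_chain2[OF arcsin_powser_deriv] DERIV_sin sin_abs_less_1 u)
  then have "((\<lambda>w. w ^ m / fact m) has_real_derivative arcsin_powser' m (sin u) * cos u) (at u)"
    by (rule has_field_derivative_transform_within_open[where S = "{-pi/2<..<pi/2}"])
      (use u in \<open>auto simp: arcsin_powser_sin\<close>)
  then have "arcsin_powser' m (sin u) * cos u = u ^ (m - 1) / fact (m - 1)"
    using power_fact_deriv[of "m - 1" u] m by (simp add: DERIV_unique)
  moreover have "(\<lambda>n. diffs (arcsin_coeff m) n * sin u ^ n * cos u) sums
      (arcsin_powser' m (sin u) * cos u)"
    unfolding arcsin_powser'_def
    by (intro sums_mult2 summable_sums summable_arcsin_coeff' sin_abs_less_1 u)
  ultimately show ?thesis by (simp add: diffs_def)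
qed


section \<open>Termwise integration against the cotangent\<close>

lemma has_integral_sin_power_cos:
  "((\<lambda>u. sin u ^ n * cos u) has_integral 1 / real (Suc n)) {0..pi / 2}"
proof -
  have "((\<lambda>u. sin u ^ n * cos u) has_integral
      (sin (pi / 2) ^ Suc n / real (Suc n) - sin 0 ^ Suc n / real (Suc n))) {0..pi / 2}"
  proof (rule fundamental_theorem_of_calculus)
    fix u :: real
    have "((\<lambda>u. sin u ^ Suc n / real (Suc n)) has_real_derivative sin u ^ n * cos u) (at u)"
      by (rule derivative_eq_intros refl | simp del: of_nat_Suc add: field_simps)+
    then show "((\<lambda>u. sin u ^ Suc n / real (Suc n)) has_vector_derivative sin u ^ n * cos u)
        (at u within {0..pi / 2})"
      using has_field_derivative_at_within has_real_derivative_iff_has_vector_derivative by blast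
  qed simp
  then show ?thesis by simp
qed

text \<open>The differentiated series dominates the partial sums, since \<open>1 \<le> n + 1\<close>.\<close>

lemma sums_integral_power_cot:
  assumes m: "m > 0"
  shows "(\<lambda>n. arcsin_coeff m (Suc n) / real (Suc n)) sums
    integral {0..pi / 2} (\<lambda>u. u ^ m / fact m * cot u)"
proof -
  let ?S = "{0<..<pi / 2}"
  define f where "f = (\<lambda>N u. \<Sum>n<N. arcsin_coeff m (Suc n) * (sin u ^ n * cos u))"
  define g where "g = (\<lambda>u::real. u ^ m / fact m * cot u)"
  \<comment> \<open>The sum of the differentiated series at u = pi/2, where it is largest.\<close>
  define B where "B = (pi / 2) ^ (m - 1) / fact (m - 1)"
  have "(f N has_integral (\<Sum>n<N. arcsin_coeff m (Suc n) * (1 / real (Suc n)))) {0..pi / 2}" for N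
    unfolding f_def by (intro has_integral_sum has_integral_mult_right has_integral_sin_power_cos) auto
  \<comment> \<open>The endpoints are removed: the expansion needs u < pi/2, and at u = 0 with m = 1
    the partial sums are 1 for N > 0 while \<open>cot 0 = 0\<close>.\<close>
  then have int: "(f N has_integral (\<Sum>n<N. arcsin_coeff m (Suc n) / real (Suc n))) ?S" for N
    by (simp add: has_integral_Icc_iff_Ioo)
  have bound: "norm (f N u) \<le> B" if u: "u \<in> ?S" for N u
  proof -
    have pos: "sin u \<ge> 0" "cos u \<ge> 0"
      using u by (auto intro!: sin_ge_zero cos_ge_zero)
    have nonneg: "arcsin_coeff m (Suc n) * (sin u ^ n * cos u) \<ge> 0" for n
      by (intro mult_nonneg_nonneg zero_le_power pos arcsin_coeff_nonneg)
    have s: "(\<lambda>n. real (Suc n) * arcsin_coeff m (Suc n) * sin u ^ n * cos u) sums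
        (u ^ (m - 1) / fact (m - 1))"
      using u by (intro sums_power_fact_deriv m) auto
    have le: "1 * (arcsin_coeff m (Suc n) * (sin u ^ n * cos u)) \<le>
        real (Suc n) * (arcsin_coeff m (Suc n) * (sin u ^ n * cos u))" for n
      by (intro mult_right_mono nonneg) simp
    have "f N u \<le> (\<Sum>n<N. real (Suc n) * arcsin_coeff m (Suc n) * sin u ^ n * cos u)"
      unfolding f_def using le by (intro sum_mono) (simp add: mult_ac)
    also have "\<dots> \<le> u ^ (m - 1) / fact (m - 1)"
    proof -
      have "0 \<le> real (Suc n) * arcsin_coeff m (Suc n) * sin u ^ n * cos u" for n
        by (intro mult_nonneg_nonneg zero_le_power pos arcsin_coeff_nonneg) simp
      then show ?thesis
        using sum_le_suminf[OF sums_summable[OF s], of "{..<N}"] sums_unique[OF s] by simp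
    qed
    also have "\<dots> \<le> B"
      unfolding B_def using u by (intro divide_right_mono power_mono) auto
    finally show ?thesis
      using sum_nonneg[of "{..<N}" "\<lambda>n. arcsin_coeff m (Suc n) * (sin u ^ n * cos u)"] nonneg
      by (simp add: f_def)
  qed
  have conv: "(\<lambda>N. f N u) \<longlonglongrightarrow> g u" if u: "u \<in> ?S" for u
  proof -
    have s0: "sin u \<noteq> 0" using u sin_gt_zero[of u] by auto
    have "(\<lambda>n. arcsin_coeff m n * sin u ^ n) sums (u ^ m / fact m)"
      using u by (intro sums_power_fact) auto
    \<comment> \<open>The coefficient at 0 vanishes since m > 0, so a factor \<open>sin u\<close>
      can be divided out to produce the cotangent.\<close>
    then have "(\<lambda>n. arcsin_coeff m (Suc n) * sin u ^ Suc n) sums (u ^ m / fact m)"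
      using m by (subst sums_Suc_iff) (cases m, auto)
    then have "(\<lambda>n. arcsin_coeff m (Suc n) * sin u ^ Suc n * (cos u / sin u)) sums
        (u ^ m / fact m * (cos u / sin u))"
      by (rule sums_mult2)
    then show ?thesis using s0 by (simp add: sums_def f_def g_def cot_def mult_ac)
  qed
  have "(\<lambda>_. B) integrable_on ?S"
    unfolding integrable_on_Icc_iff_Ioo[symmetric] by auto
  then have "(\<lambda>N. integral ?S (f N)) \<longlonglongrightarrow> integral ?S g"
    using dominated_convergence(2)[of f ?S "\<lambda>_. B" g] int bound conv by (auto simp: integrable_on_def)
  moreover have "integral ?S (f N) = (\<Sum>n<N. arcsin_coeff m (Suc n) / real (Suc n))" for N
    using int by (rule integral_unique)
  moreover have "integral ?S g = integral {0..pi / 2} g"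
    by (simp add: integral_open_interval_real)
  ultimately show ?thesis by (simp add: sums_def g_def)
qed

lemma cot_integral_altdef:
  "cot_integral m = 2 ^ m * integral {0..pi / 2} (\<lambda>u. u ^ m / fact m * cot u)"
proof -
  have "(\<lambda>x. x / 2) ` {0..pi} = {0..pi / 2}"
    by (simp add: image_divide_atLeastAtMost)
  then have "integral {0..pi} (\<lambda>\<theta>. \<theta> ^ m / 2 * cot (\<theta> / 2)) =
      2 * integral {0..pi / 2} (\<lambda>u. (2 * u) ^ m / 2 * cot (2 * u / 2))"
    using integral_stretch_real[of 2 0 pi "\<lambda>\<theta>. \<theta> ^ m / 2 * cot (\<theta> / 2)"] by simp
  also have "(\<lambda>u. (2 * u) ^ m / 2 * cot (2 * u / 2)) =
      (\<lambda>u::real. 2 ^ m * fact m / 2 * (u ^ m / fact m * cot u))"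
    by (simp add: power_mult_distrib fun_eq_iff)
  also have "integral {0..pi / 2} \<dots> =
      2 ^ m * fact m / 2 * integral {0..pi / 2} (\<lambda>u. u ^ m / fact m * cot u)"
    by (rule integral_mult_right)
  finally show ?thesis by (simp add: cot_integral_def)
qed

section \<open>Elementary and complete symmetric functions\<close>

text \<open>The elementary symmetric polynomial e_k of a_0, ..., a_(n-1), expanded along the largest
  index chosen.\<close>

primrec elem_sym :: "(nat \<Rightarrow> real) \<Rightarrow> nat \<Rightarrow> nat \<Rightarrow> real" where
  "elem_sym a 0 n = 1"
| "elem_sym a (Suc k) n = (\<Sum>i<n. a i * elem_sym a k i)"

text \<open>The complete homogeneous symmetric function h_l of the tail a_n, a_(n+1), ..., expanded
  along the smallest index, which matches the shape of \<open>nested_sum\<close>.\<close>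

primrec complete_sym :: "(nat \<Rightarrow> real) \<Rightarrow> nat \<Rightarrow> nat \<Rightarrow> real" where
  "complete_sym a 0 n = 1"
| "complete_sym a (Suc l) n = (\<Sum>i. a (n + i) * complete_sym a l (n + i))"

lemma elem_sym_nonneg: "(\<And>i. a i \<ge> 0) \<Longrightarrow> elem_sym a k n \<ge> 0"
  by (induction k arbitrary: n) (auto intro!: sum_nonneg)

lemma incseq_elem_sym: "(\<And>i. a i \<ge> 0) \<Longrightarrow> incseq (elem_sym a k)"
  by (cases k) (auto intro!: incseq_SucI simp: elem_sym_nonneg)

context
  fixes a :: "nat \<Rightarrow> real"
  assumes nonneg: "\<And>i. a i \<ge> 0" and summable: "summable a"
begin

lemma summable_mult_decseq:
  assumes "\<And>n. 0 \<le> h n" "decseq h"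
  shows "summable (\<lambda>i. a i * h i)"
proof (rule summable_comparison_test')
  show "summable (\<lambda>i. a i * h 0)" using summable by (rule summable_mult2)
  show "norm (a i * h i) \<le> a i * h 0" if "i \<ge> 0" for i
    using assms(1)[of i] decseqD[OF assms(2), of 0 i] nonneg[of i]
    by (simp add: abs_mult mult_left_mono)
qed

text \<open>One joint induction, because summability at the next level uses both sign and
  monotonicity at the present one.\<close>

lemma complete_sym_nonneg_decseq: "(\<forall>n. complete_sym a l n \<ge> 0) \<and> decseq (complete_sym a l)"
proof (induction l)
  case (Suc l)
  let ?f = "\<lambda>i. a i * complete_sym a l i"
  have s: "summable ?f" using Suc by (intro summable_mult_decseq) auto
  have s': "summable (\<lambda>i. ?f (n + i))" for n
    using summable_ignore_initial_segment[OF s, of n] by (simp add: add.commute)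
  have f: "?f i \<ge> 0" for i using Suc nonneg by simp
  have "complete_sym a (Suc l) (Suc n) \<le> complete_sym a (Suc l) n" for n
    using suminf_split_head[OF s'[of n]] f[of n] by simp
  then show ?case using f s' by (auto intro!: decseq_SucI suminf_nonneg)
qed (auto simp: decseq_def)

lemma complete_sym_nonneg: "complete_sym a l n \<ge> 0"
  and complete_sym_le: "complete_sym a l n \<le> complete_sym a l 0"
  using complete_sym_nonneg_decseq[of l] by (auto simp: decseq_def)

lemma summable_complete_sym: "summable (\<lambda>i. a i * complete_sym a l i)"
  using complete_sym_nonneg_decseq by (intro summable_mult_decseq) auto

lemma summable_complete_sym_shift: "summable (\<lambda>i. a (n + i) * complete_sym a l (n + i))"
  using summable_ignore_initial_segment[OF summable_complete_sym, of n] by (simp add: add.commute)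

lemma complete_sym_rec:
  "complete_sym a (Suc l) n = a n * complete_sym a l n + complete_sym a (Suc l) (Suc n)"
  using suminf_split_head[OF summable_complete_sym_shift[of n l]] by simp

lemma complete_sym_tendsto_0: "complete_sym a (Suc l) \<longlonglongrightarrow> 0"
proof -
  have "complete_sym a (Suc l) = (\<lambda>n. \<Sum>k. a (k + n) * complete_sym a l (k + n))"
    by (simp add: fun_eq_iff add.commute)
  then show ?thesis using suminf_exist_split2[OF summable_complete_sym, of l] by simp
qed

text \<open>
  The coefficients of
  \<open>\<Prod>i<n. (1 + a i t) = (\<Prod>i. 1 + a i t) * (\<Prod>i\<ge>n. 1 / (1 + a i t))\<close>.
  Both sides have the same increments in \<open>n\<close> and the same limit.
\<close>

lemma elem_sym_eq_sum_complete_sym: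
  assumes lim: "\<And>k. elem_sym a k \<longlonglongrightarrow> E k"
  shows "elem_sym a k n = (\<Sum>l\<le>k. (-1) ^ l * E (k - l) * complete_sym a l n)"
proof (induction k arbitrary: n)
  case 0
  have "elem_sym a 0 = (\<lambda>_. 1)" by (simp add: fun_eq_iff)
  with lim[of 0] have "(\<lambda>_. 1 :: real) \<longlonglongrightarrow> E 0" by simp
  then have "E 0 = 1" by (simp add: LIMSEQ_const_iff)
  then show ?case by simp
next
  case (Suc k)
  define D where "D = (\<lambda>n. \<Sum>l\<le>Suc k. (-1) ^ l * E (Suc k - l) * complete_sym a l n)"
  have D: "D n = E (Suc k) + (\<Sum>l\<le>k. (-1) ^ Suc l * E (k - l) * complete_sym a (Suc l) n)" for n
    unfolding D_def by (subst sum.atMost_Suc_shift) simp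
  define d where "d = (\<lambda>n. elem_sym a (Suc k) n - D n)"
  have "d (Suc n) = d n" for n
  proof -
    \<comment> \<open>\<open>complete_sym_rec\<close> isolates the factor \<open>a n\<close>; what
      it multiplies is the induction hypothesis for e_k. Hence \<open>D\<close> has the same
      increments as \<open>elem_sym a (Suc k)\<close>.\<close>
    have "D n = E (Suc k) + (\<Sum>l\<le>k. (-1) ^ Suc l * E (k - l) * complete_sym a (Suc l) (Suc n)
        - a n * ((-1) ^ l * E (k - l) * complete_sym a l n))"
      unfolding D complete_sym_rec[of _ n] power_Suc
      by (intro arg_cong2[where f = "(+)"] sum.cong refl) algebra
    also have "\<dots> = D (Suc n) - a n * elem_sym a k n"
      unfolding D Suc.IH by (simp add: sum_subtractf sum_distrib_left)
    finally show ?thesis by (simp add: d_def)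
  qed
  then have const: "d n = d 0" for n by (induction n) auto
  \<comment> \<open>Only the term l = 0 survives at infinity.\<close>
  have "D \<longlonglongrightarrow> E (Suc k) + (\<Sum>l\<le>k. (-1) ^ Suc l * E (k - l) * 0)"
    unfolding D by (intro tendsto_intros complete_sym_tendsto_0)
  then have "D \<longlonglongrightarrow> E (Suc k)" by simp
  with lim have "d \<longlonglongrightarrow> E (Suc k) - E (Suc k)" unfolding d_def by (rule tendsto_diff)
  moreover have "d = (\<lambda>_. d 0)" using const by blast
  ultimately have "d 0 = 0" by (metis LIMSEQ_const_iff diff_self)
  with const[of n] show ?case by (simp add: d_def D_def)
qed

text \<open>h_l is homogeneous of degree l. This will pass from the numbers 1/(2i+2)^2 to 1/j^2 with
  j = i + 1.\<close>

lemma complete_sym_scale_shift: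
  "complete_sym (\<lambda>i. c * a (Suc i)) l n = c ^ l * complete_sym a l (Suc n)"
proof (induction l arbitrary: n)
  case (Suc l)
  have "complete_sym (\<lambda>i. c * a (Suc i)) (Suc l) n =
      (\<Sum>i. c ^ Suc l * (a (Suc n + i) * complete_sym a l (Suc n + i)))"
    by (simp add: Suc.IH mult_ac)
  also have "\<dots> = c ^ Suc l * complete_sym a (Suc l) (Suc n)"
    unfolding complete_sym.simps by (intro suminf_mult summable_complete_sym_shift)
  finally show ?case .
qed simp

text \<open>The factor \<open>c\<close> is generalized in the induction so that it can absorb
  \<open>a j\<close> for each outer summation variable.\<close>

lemma nested_sum_eq_complete_sym:
  "nested_sum l n (\<lambda>js. c * (\<Prod>j\<leftarrow>js. a j)) = c * complete_sym a l n"
proof (induction l arbitrary: n c)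
  case (Suc l)
  have "nested_sum (Suc l) n (\<lambda>js. c * (\<Prod>j\<leftarrow>js. a j)) =
      sum_from n (\<lambda>j. nested_sum l j (\<lambda>js. (c * a j) * (\<Prod>j\<leftarrow>js. a j)))"
    by (simp add: mult_ac)
  also have "\<dots> = (\<Sum>i. c * (a (n + i) * complete_sym a l (n + i)))"
    by (simp only: Suc.IH sum_from_def) (simp only: mult.assoc)
  also have "\<dots> = c * complete_sym a (Suc l) n"
    unfolding complete_sym.simps by (intro suminf_mult summable_complete_sym_shift)
  finally show ?case .
qed simp

end

lemma one_div_prod_list: "1 / (\<Prod>j\<leftarrow>js. b j) = (\<Prod>j\<leftarrow>js. 1 / b j :: real)"
  by (induction js) (auto simp: mult.commute[of "b x" for x] simp flip: divide_divide_eq_left)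

lemma nested_sum_one_div:
  assumes "\<And>i. b i \<ge> 0" "summable (\<lambda>i. 1 / b i)"
  shows "nested_sum l n (\<lambda>js. 1 / (\<Prod>j\<leftarrow>js. b j)) = complete_sym (\<lambda>i. 1 / b i) l n"
  unfolding one_div_prod_list
  using nested_sum_eq_complete_sym[of "\<lambda>i. 1 / b i" l n 1] assms by simp

section \<open>An Abelian limit argument\<close>

text \<open>The total mass of the weights \<open>f j u\<close> tends to \<open>c\<close> while each
  single weight tends to 0, so the mass escapes to large \<open>j\<close> and the weighted mean sees
  only the limit of \<open>e\<close>. Monotonicity of \<open>e\<close> supplies both
  inequalities.\<close>

lemma tendsto_incseq_of_weighted_sums:
  fixes f :: "nat \<Rightarrow> 'a \<Rightarrow> real"
  assumes F: "F \<noteq> bot"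
    and nonneg: "\<forall>\<^sub>F u in F. \<forall>j. f j u \<ge> 0"
    and sums: "\<forall>\<^sub>F u in F. (\<lambda>j. f j u) sums g u" "\<forall>\<^sub>F u in F. (\<lambda>j. f j u * e j) sums h u"
    and lim: "\<And>j. (f j \<longlongrightarrow> 0) F" "(g \<longlongrightarrow> c) F" "(h \<longlongrightarrow> d) F"
    and c: "c > 0" and e: "incseq e"
  shows "e \<longlonglongrightarrow> d / c"
proof -
  \<comment> \<open>The terms with j \<ge> N are nonnegative; dropping them leaves a finite sum that
    tends to 0. This also shows that \<open>e\<close> is bounded.\<close>
  have upper: "e N \<le> d / c" for N
  proof -
    have "\<forall>\<^sub>F u in F. (\<Sum>j<N. f j u * (e j - e N)) \<le> h u - g u * e N"
      using nonneg sums
    proof eventually_elim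
      case (elim u)
      have s: "(\<lambda>j. f j u * (e j - e N)) sums (h u - g u * e N)"
        using sums_diff[OF elim(3) sums_mult2[OF elim(2)]] by (simp add: algebra_simps)
      have "0 \<le> f j u * (e j - e N)" if "j \<in> - {..<N}" for j
        using elim(1) that incseqD[OF e, of N j] by simp
      then show ?case
        using sum_le_suminf[OF sums_summable[OF s], of "{..<N}"] sums_unique[OF s] by simp
    qed
    moreover have "((\<lambda>u. \<Sum>j<N. f j u * (e j - e N)) \<longlongrightarrow> (\<Sum>j<N. 0 * (e j - e N))) F"
      by (intro tendsto_intros lim)
    moreover have "((\<lambda>u. h u - g u * e N) \<longlongrightarrow> d - c * e N) F"
      by (intro tendsto_intros lim)
    ultimately have "(\<Sum>j<N. 0 * (e j - e N)) \<le> d - c * e N"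
      using F by (intro tendsto_le) auto
    then show ?thesis using c by (simp add: field_simps)
  qed
  then obtain L where L: "e \<longlonglongrightarrow> L" "\<And>i. e i \<le> L"
    using incseq_convergent[OF e] by metis
  have "\<forall>\<^sub>F u in F. h u \<le> g u * L"
    using nonneg sums
  proof eventually_elim
    case (elim u)
    show ?case
      by (rule sums_le[OF _ elim(3) sums_mult2[OF elim(2)]]) (use elim(1) L(2) in \<open>simp add: mult_left_mono\<close>)
  qed
  moreover have "((\<lambda>u. g u * L) \<longlongrightarrow> c * L) F" by (intro tendsto_intros lim)
  ultimately have "d \<le> c * L" using F lim by (intro tendsto_le)
  moreover have "L \<le> d / c" using L(1) upper by (intro LIMSEQ_le_const2) auto
  ultimately have "L = d / c" using c by (intro antisym) (auto simp: field_simps)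
  with L show ?thesis by simp
qed

section \<open>Limits of the symmetric functions of inverse squares\<close>

text \<open>The values \<open>q = 0\<close> and \<open>q = 1\<close> give the odd and the even half of the theorem.\<close>

definition inv_square :: "nat \<Rightarrow> nat \<Rightarrow> real" where
  "inv_square q i = 1 / (real (Suc (2 * i + q)))\<^sup>2"

lemma inv_square_nonneg: "inv_square q i \<ge> 0"
  by (simp add: inv_square_def)

lemma summable_inverse_squares: "summable (\<lambda>i. 1 / (real i)\<^sup>2)"
  using inverse_power_summable[of 2, where 'a = real] by (simp add: inverse_eq_divide)

lemma summable_inv_square: "summable (inv_square q)"
proof (rule summable_comparison_test')
  show "summable (\<lambda>i. 1 / (real (Suc i))\<^sup>2)"
    using summable_inverse_squares by (subst summable_Suc_iff)
  show "norm (inv_square q i) \<le> 1 / (real (Suc i))\<^sup>2" if "i \<ge> 0" for i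
    unfolding inv_square_def by (auto intro!: divide_left_mono power_mono)
qed

text \<open>Dividing the coefficient recurrence for 2k + 3 + q by the one for 1 + q leaves
  e_(k+1)(j+1) = e_(k+1)(j) + a_j e_k(j), the recurrence of \<open>elem_sym\<close> with a =
  \<open>inv_square q\<close>.\<close>

lemma arcsin_coeff_eq_elem_sym:
  assumes q: "q < 2"
  shows "arcsin_coeff (Suc (2 * k + q)) (Suc (2 * j + q)) =
    arcsin_coeff (Suc q) (Suc (2 * j + q)) * elem_sym (inv_square q) k j"
proof (induction k arbitrary: j)
  case (Suc k)
  show ?case
  proof (induction j)
    case 0
    show ?case using q by (auto simp: less_2_cases_iff arcsin_coeff.simps(4))
  next
    case (Suc j)
    let ?n = "Suc (2 * j + q)"
    let ?c = "(real ?n + 1) * (real ?n + 2)"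
    \<comment> \<open>The inhomogeneous term is absent for q = 0, and for q = 1 it is
      \<open>arcsin_coeff 0\<close> at a positive index, hence 0.\<close>
    have base: "?c * arcsin_coeff (Suc q) (?n + 2) = real ?n ^ 2 * arcsin_coeff (Suc q) ?n"
      using q by (subst arcsin_coeff_rec) (auto simp: less_2_cases_iff)
    have "?c * arcsin_coeff (Suc (2 * Suc k + q)) (?n + 2) =
        real ?n ^ 2 * arcsin_coeff (Suc (2 * Suc k + q)) ?n + arcsin_coeff (Suc (2 * k + q)) ?n"
      by (subst arcsin_coeff_rec) simp_all
    also have "\<dots> = real ?n ^ 2 * arcsin_coeff (Suc q) ?n *
        (elem_sym (inv_square q) (Suc k) j + inv_square q j * elem_sym (inv_square q) k j)"
      unfolding Suc.IH \<open>\<And>j. arcsin_coeff (Suc (2 * k + q)) (Suc (2 * j + q)) = _ j\<close>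
      by (simp add: inv_square_def field_simps del: of_nat_Suc elem_sym.simps)
    also have "\<dots> = ?c * (arcsin_coeff (Suc q) (?n + 2) * elem_sym (inv_square q) (Suc k) (Suc j))"
      unfolding base[symmetric] by simp
    finally have "arcsin_coeff (Suc (2 * Suc k + q)) (?n + 2) =
        arcsin_coeff (Suc q) (?n + 2) * elem_sym (inv_square q) (Suc k) (Suc j)"
      by (subst (asm) mult_left_cancel) auto
    then show ?case by simp
  qed
qed simp

text \<open>By parity only the indices n = 2j + q contribute. The factor \<open>x\<close> is left
  free to cover both the integrated and the differentiated series.\<close>

lemma sums_arcsin_coeff_reindex:
  assumes q: "q < 2"
  shows "(\<lambda>j. arcsin_coeff (Suc (2 * k + q)) (Suc (2 * j + q)) * x (2 * j + q)) sums s \<longleftrightarrow>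
    (\<lambda>n. arcsin_coeff (Suc (2 * k + q)) (Suc n) * x n) sums s"
proof (rule sums_mono_reindex[of "\<lambda>j. 2 * j + q"])
  show "strict_mono (\<lambda>j. 2 * j + q)" by (auto simp: strict_mono_def)
  fix n assume n: "n \<notin> range (\<lambda>j. 2 * j + q)"
  have "odd (n + q)"
  proof
    assume even: "even (n + q)"
    show False
    proof (cases "n \<ge> q")
      case True
      then have "n = 2 * ((n - q) div 2) + q" using even by auto
      then show False using n by blast
    next
      case False
      then show False using even q by (cases n) (auto simp: less_2_cases_iff)
    qed
  qed
  then show "arcsin_coeff (Suc (2 * k + q)) (Suc n) * x n = 0"
    by (simp add: arcsin_coeff_parity)
qed

text \<open>With z = (pi/2) sqrt t, these are the coefficients of t^k in cosh z (q = 0) and sinh z /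
  z (q = 1), as in Euler's products. Here they come from comparing the differentiated series for k
  with the one for k = 0 as u tends to pi/2.\<close>

lemma elem_sym_tendsto:
  assumes q: "q < 2"
  shows "elem_sym (inv_square q) k \<longlonglongrightarrow> (pi / 2) ^ (2 * k) / fact (2 * k + q)"
proof -
  \<comment> \<open>The factor \<open>cos u\<close> sends each term to 0, while the sum over
    \<open>j\<close> remains \<open>u ^ q / fact q\<close>.\<close>
  define f where "f = (\<lambda>j u. arcsin_coeff (Suc q) (Suc (2 * j + q)) *
    (real (Suc (2 * j + q)) * sin u ^ (2 * j + q) * cos u))"
  have ev: "\<forall>\<^sub>F u in at_left (pi / 2). u \<in> {0<..<pi / 2}"
    by (rule eventually_at_left_real) simp
  have sums: "(\<lambda>j. f j u * elem_sym (inv_square q) k j) sums (u ^ (2 * k + q) / fact (2 * k + q))"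
    if u: "u \<in> {0<..<pi / 2}" for u k
  proof -
    have "(\<lambda>n. arcsin_coeff (Suc (2 * k + q)) (Suc n) * (real (Suc n) * sin u ^ n * cos u)) sums
        (u ^ (2 * k + q) / fact (2 * k + q))"
      using sums_power_fact_deriv[of u "Suc (2 * k + q)"] u by (simp add: mult_ac)
    then have "(\<lambda>j. arcsin_coeff (Suc (2 * k + q)) (Suc (2 * j + q)) *
        (real (Suc (2 * j + q)) * sin u ^ (2 * j + q) * cos u)) sums
        (u ^ (2 * k + q) / fact (2 * k + q))"
      by (subst sums_arcsin_coeff_reindex[OF q, where x = "\<lambda>n. real (Suc n) * sin u ^ n * cos u"])
    then show ?thesis
      unfolding arcsin_coeff_eq_elem_sym[OF q] f_def by (simp only: mult_ac)
  qed
  have "elem_sym (inv_square q) k \<longlonglongrightarrow>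
      ((pi / 2) ^ (2 * k + q) / fact (2 * k + q)) / ((pi / 2) ^ q / fact q)"
  proof (rule tendsto_incseq_of_weighted_sums[where F = "at_left (pi / 2)" and f = f])
    show "\<forall>\<^sub>F u in at_left (pi / 2). \<forall>j. 0 \<le> f j u"
      using ev
    proof eventually_elim
      case (elim u)
      then have "sin u \<ge> 0" "cos u \<ge> 0" by (auto intro!: sin_ge_zero cos_ge_zero)
      then show ?case unfolding f_def by (auto intro!: mult_nonneg_nonneg arcsin_coeff_nonneg)
    qed
    show "\<forall>\<^sub>F u in at_left (pi / 2). (\<lambda>j. f j u) sums (u ^ q / fact q)"
      using ev by eventually_elim (use sums[where k = 0] in simp)
    show "\<forall>\<^sub>F u in at_left (pi / 2). (\<lambda>j. f j u * elem_sym (inv_square q) k j) sums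
        (u ^ (2 * k + q) / fact (2 * k + q))"
      using ev by eventually_elim (rule sums)
    show "(f j \<longlongrightarrow> 0) (at_left (pi / 2))" for j
    proof -
      have "(f j \<longlongrightarrow> arcsin_coeff (Suc q) (Suc (2 * j + q)) *
          (real (Suc (2 * j + q)) * sin (pi / 2) ^ (2 * j + q) * cos (pi / 2))) (at_left (pi / 2))"
        unfolding f_def by (intro tendsto_intros)
      then show ?thesis by simp
    qed
    show "incseq (elem_sym (inv_square q) k)"
      by (intro incseq_elem_sym inv_square_nonneg)
  qed (auto intro!: tendsto_intros)
  moreover have "fact q = (1 :: real)" using q by (auto simp: less_2_cases_iff)
  ultimately show ?thesis by (simp add: power_add)
qed

definition arcsin_series :: "nat \<Rightarrow> nat \<Rightarrow> real" where
  "arcsin_series q l = (\<Sum>j. arcsin_coeff (Suc q) (Suc (2 * j + q)) / real (Suc (2 * j + q)) *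
     complete_sym (inv_square q) l j)"

lemma sums_cot_integral:
  assumes q: "q < 2"
  shows "(\<lambda>j. arcsin_coeff (Suc q) (Suc (2 * j + q)) / real (Suc (2 * j + q)) *
      elem_sym (inv_square q) k j) sums (cot_integral (Suc (2 * k + q)) / 2 ^ Suc (2 * k + q))"
proof -
  have "(\<lambda>n. arcsin_coeff (Suc (2 * k + q)) (Suc n) * (1 / real (Suc n))) sums
      (cot_integral (Suc (2 * k + q)) / 2 ^ Suc (2 * k + q))"
    using sums_integral_power_cot[of "Suc (2 * k + q)"] by (simp add: cot_integral_altdef)
  then have "(\<lambda>j. arcsin_coeff (Suc (2 * k + q)) (Suc (2 * j + q)) * (1 / real (Suc (2 * j + q)))) sums
      (cot_integral (Suc (2 * k + q)) / 2 ^ Suc (2 * k + q))"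
    by (subst sums_arcsin_coeff_reindex[OF q, where x = "\<lambda>n. 1 / real (Suc n)"])
  then show ?thesis
    unfolding arcsin_coeff_eq_elem_sym[OF q] by (simp add: mult_ac)
qed

lemma sums_arcsin_series:
  assumes q: "q < 2"
  shows "(\<lambda>j. arcsin_coeff (Suc q) (Suc (2 * j + q)) / real (Suc (2 * j + q)) *
      complete_sym (inv_square q) l j) sums arcsin_series q l"
proof -
  let ?h = "complete_sym (inv_square q) l"
  let ?w = "\<lambda>j. arcsin_coeff (Suc q) (Suc (2 * j + q)) / real (Suc (2 * j + q))"
  have "summable (\<lambda>j. ?w j * ?h j)"
  proof (rule summable_comparison_test')
    \<comment> \<open>The case k = 0 of \<open>sums_cot_integral\<close>, where
      \<open>elem_sym\<close> is 1, makes the bare weights summable.\<close>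
    show "summable (\<lambda>j. ?w j * ?h 0)"
      using sums_summable[OF sums_cot_integral[OF q, of 0]] by (intro summable_mult2) simp
    show "norm (?w j * ?h j) \<le> ?w j * ?h 0" if "j \<ge> 0" for j
    proof -
      have "?w j \<ge> 0" by (intro divide_nonneg_nonneg arcsin_coeff_nonneg) simp
      moreover have "0 \<le> ?h j" "?h j \<le> ?h 0"
        by (intro complete_sym_nonneg complete_sym_le inv_square_nonneg summable_inv_square)+
      ultimately show ?thesis
        by (simp only: real_norm_def abs_of_nonneg mult_nonneg_nonneg mult_left_mono)
    qed
  qed
  then show ?thesis by (simp add: sums_iff arcsin_series_def)
qed

text \<open>Expands e_k through the h_l. The sum over \<open>l\<close> is finite and each series
  over \<open>j\<close> converges, so they may be interchanged.\<close>

lemma cot_integral_eq_arcsin_series: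
  assumes q: "q < 2"
  shows "cot_integral (Suc (2 * k + q)) = 2 ^ Suc (2 * k + q) *
    (\<Sum>l\<le>k. (-1) ^ l * ((pi / 2) ^ (2 * (k - l)) / fact (2 * (k - l) + q)) * arcsin_series q l)"
proof -
  define E where "E = (\<lambda>k. (pi / 2) ^ (2 * k) / fact (2 * k + q) :: real)"
  let ?w = "\<lambda>j. arcsin_coeff (Suc q) (Suc (2 * j + q)) / real (Suc (2 * j + q))"
  let ?h = "complete_sym (inv_square q)"
  have "(\<lambda>j. \<Sum>l\<le>k. (-1) ^ l * E (k - l) * (?w j * ?h l j)) sums
      (\<Sum>l\<le>k. (-1) ^ l * E (k - l) * arcsin_series q l)"
    by (intro sums_sum sums_mult sums_arcsin_series q)
  moreover have "(\<Sum>l\<le>k. (-1) ^ l * E (k - l) * (?w j * ?h l j)) =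
      ?w j * elem_sym (inv_square q) k j" for j
    unfolding elem_sym_eq_sum_complete_sym[OF inv_square_nonneg summable_inv_square
        elem_sym_tendsto[OF q]] sum_distrib_left E_def by (simp add: mult_ac)
  ultimately have "cot_integral (Suc (2 * k + q)) / 2 ^ Suc (2 * k + q) =
      (\<Sum>l\<le>k. (-1) ^ l * E (k - l) * arcsin_series q l)"
    using sums_cot_integral[OF q, of k] by (simp only: sums_unique2)
  then show ?thesis by (simp add: E_def field_simps)
qed

section \<open>Central binomial coefficients and the identification of \<open>S1\<close> and
  \<open>S0\<close>\<close>

lemma central_binomial_rec:
  "(real j + 1) * real (2 * Suc j choose Suc j) = 2 * (2 * real j + 1) * real (2 * j choose j)"
proof -
  have eq: "real (2 * i choose i) = fact (2 * i) / (fact i)\<^sup>2" for i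
    by (subst binomial_fact) (auto simp: power2_eq_square)
  \<comment> \<open>Applied with x = j, F = (2j)! and G = j!.\<close>
  have "(x + 1) * (((2 * x + 2) * (2 * x + 1) * F) / ((x + 1) * G)\<^sup>2) =
      2 * (2 * x + 1) * (F / G\<^sup>2)" if "x + 1 \<noteq> 0" for x F G :: real
    using that by (simp add: divide_simps power2_eq_square) (simp add: algebra_simps)
  moreover have "fact (2 * Suc j) = (2 * real j + 2) * (2 * real j + 1) * fact (2 * j)"
    "fact (Suc j) = (real j + 1) * fact j"
    by (simp_all add: algebra_simps)
  ultimately show ?thesis by (simp only: eq)
qed

lemma arcsin_coeff_1:
  "arcsin_coeff 1 (Suc (2 * j)) = real (2 * j choose j) * (1 / 2) ^ (2 * j) / (2 * real j + 1)"
proof (induction j)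
  case (Suc j)
  have "(2 * real j + 2) * (2 * real j + 3) * arcsin_coeff 1 (Suc (2 * Suc j)) =
      (2 * real j + 1)\<^sup>2 * arcsin_coeff 1 (Suc (2 * j))"
    using arcsin_coeff_rec[of 1 "Suc (2 * j)"] by (simp add: add_ac)
  also have "\<dots> = (2 * (2 * real j + 1) * real (2 * j choose j)) * (1 / 2) ^ (2 * j) / 2"
    unfolding Suc.IH by (simp add: power2_eq_square)
  also have "\<dots> = (2 * real j + 2) * (2 * real j + 3) *
      (real (2 * Suc j choose Suc j) * (1 / 2) ^ (2 * Suc j) / (2 * real (Suc j) + 1))"
    unfolding central_binomial_rec[symmetric]
    by (simp add: divide_simps del: binomial_Suc_Suc) (simp add: algebra_simps del: binomial_Suc_Suc)
  finally show ?case by (subst (asm) mult_left_cancel) auto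
qed simp

text \<open>The induction starts at the coefficient of x^2: at n = 0 the recurrence still has the
  inhomogeneous term \<open>arcsin_coeff 0 0 = 1\<close>, afterwards it is homogeneous.\<close>

lemma arcsin_coeff_2:
  "arcsin_coeff 2 (2 * Suc j) =
    2 ^ (2 * Suc j) / real (2 * Suc j choose Suc j) / (4 * (real (Suc j))\<^sup>2)"
proof (induction j)
  case (Suc j)
  let ?n = "Suc j"
  have "(2 * real ?n + 1) * (2 * real ?n + 2) * arcsin_coeff 2 (2 * Suc ?n) =
      (2 * real ?n)\<^sup>2 * arcsin_coeff 2 (2 * ?n)"
    using arcsin_coeff_rec[of 2 "2 * ?n"] by (simp add: add_ac)
  also have "\<dots> = 2 ^ (2 * ?n) / real (2 * ?n choose ?n)"
    unfolding Suc.IH by (simp add: field_simps del: binomial_Suc_Suc of_nat_Suc)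
  also have "\<dots> = (2 * real ?n + 1) * (2 * real ?n + 2) *
      (2 ^ (2 * Suc ?n) / real (2 * Suc ?n choose Suc ?n) / (4 * (real (Suc ?n))\<^sup>2))"
  proof -
    have "real (2 * Suc ?n choose Suc ?n) =
        2 * (2 * real ?n + 1) * real (2 * ?n choose ?n) / (real ?n + 1)"
      using central_binomial_rec[of ?n] by (simp add: field_simps del: binomial_Suc_Suc of_nat_Suc)
    then show ?thesis
      by (simp add: divide_simps power2_eq_square del: binomial_Suc_Suc)
        (simp add: algebra_simps del: binomial_Suc_Suc)
  qed
  finally show ?case by (subst (asm) mult_left_cancel) auto
qed (simp add: numeral_2_eq_2 arcsin_coeff.simps(4))

lemma S1_eq: "S1 l = arcsin_series 0 l"
proof -
  have "nested_sum l n (\<lambda>js. 1 / (\<Prod>j\<leftarrow>js. (2 * real j + 1)\<^sup>2)) = complete_sym (inv_square 0) l n" for n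
    using nested_sum_one_div[of "\<lambda>j. (2 * real j + 1)\<^sup>2" l n] summable_inv_square[of 0]
    by (simp add: inv_square_def[abs_def] add.commute)
  moreover have "real (2 * j choose j) * (1 / 2) ^ (2 * j) * (1 / (2 * real j + 1)\<^sup>2) =
      arcsin_coeff (Suc 0) (Suc (2 * j)) / real (Suc (2 * j))" for j
    using arcsin_coeff_1[of j] by (simp add: power2_eq_square add.commute)
  ultimately show ?thesis
    unfolding S1_def arcsin_series_def sum_from_def by simp
qed

lemma S0_eq: "S0 l = 4 ^ Suc l * arcsin_series 1 l"
proof -
  let ?h = "complete_sym (\<lambda>i. 1 / (real i)\<^sup>2) l"
  have nested: "nested_sum l n (\<lambda>js. 1 / (\<Prod>j\<leftarrow>js. (real j)\<^sup>2)) = ?h n" for n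
    using nested_sum_one_div[of "\<lambda>j. (real j)\<^sup>2" l n] summable_inverse_squares by simp
  \<comment> \<open>The shift to \<open>Suc i\<close> matches the outer sum starting at 1 and avoids
    the default value 1/0 = 0.\<close>
  have "inv_square 1 = (\<lambda>i. 1 / 4 * (1 / (real (Suc i))\<^sup>2))"
    by (simp add: fun_eq_iff inv_square_def power2_eq_square algebra_simps)
  then have scale: "complete_sym (inv_square 1) l n = (1 / 4) ^ l * ?h (Suc n)" for n
    using complete_sym_scale_shift[of "\<lambda>i. 1 / (real i)\<^sup>2" "1 / 4" l n] summable_inverse_squares
    by simp
  have term_eq: "1 / 2 * (2 ^ (2 * Suc j) / real (2 * Suc j choose Suc j) * (1 / real (Suc j) ^ 3) * ?h (Suc j)) =
      4 ^ Suc l * (arcsin_coeff (Suc 1) (Suc (2 * j + 1)) / real (Suc (2 * j + 1)) * complete_sym (inv_square 1) l j)" for j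
  proof -
    have "arcsin_coeff (Suc 1) (Suc (2 * j + 1)) =
        2 ^ (2 * Suc j) / real (2 * Suc j choose Suc j) / (4 * (real (Suc j))\<^sup>2)"
      using arcsin_coeff_2[of j] by (simp add: numeral_2_eq_2 del: binomial_Suc_Suc)
    moreover have "real (Suc (2 * j + 1)) = 2 * real (Suc j)" by simp
    moreover have "(4 :: real) ^ Suc l * (1 / 4) ^ l = 4" by (simp add: power_divide)
    ultimately show ?thesis
      unfolding scale by (simp add: power2_eq_square power3_eq_cube field_simps
          del: binomial_Suc_Suc of_nat_Suc)
  qed
  have "(\<lambda>j. 1 / 2 * (2 ^ (2 * Suc j) / real (2 * Suc j choose Suc j) * (1 / real (Suc j) ^ 3) *
      ?h (Suc j))) sums (4 ^ Suc l * arcsin_series 1 l)"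
    unfolding term_eq by (intro sums_mult sums_arcsin_series) simp
  \<comment> \<open>\<open>S0\<close> has its factor 1/2 outside the series, so it is stripped from
    the terms here.\<close>
  from sums_mult_D[OF this]
  have "sum_from 1 (\<lambda>j. 2 ^ (2 * j) / real (2 * j choose j) * (1 / real j ^ 3) * ?h j) =
      4 ^ Suc l * arcsin_series 1 l / (1 / 2)"
    unfolding sum_from_def plus_1_eq_Suc by (intro sums_unique[symmetric]) simp
  then show ?thesis
    unfolding S0_def nested by simp
qed

section \<open>Collecting the powers of 2 and pi\<close>

theorem theorem3:
  fixes k :: nat
  shows "cot_integral (2 * k + 1) =
           (\<Sum>l=0..k. (-1) ^ l * (2 ^ (2 * l + 1) * pi ^ (2 * k - 2 * l) / fact (2 * k - 2 * l)) * S1 l)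
       \<and> cot_integral (2 * k + 2) =
           (\<Sum>l=0..k. (-1) ^ l * (pi ^ (2 * k - 2 * l) / fact (2 * k - 2 * l + 1)) * S0 l)"
proof
  have pow: "(2 :: real) ^ Suc (2 * k) * (pi / 2) ^ (2 * (k - l)) = 2 ^ (2 * l + 1) * pi ^ (2 * (k - l))"
    if "l \<le> k" for l
  proof -
    have "(2 :: real) ^ Suc (2 * k) = 2 ^ (2 * l + 1) * 2 ^ (2 * (k - l))"
      using that by (simp flip: power_add)
    then show ?thesis by (simp add: power_divide)
  qed
  have "cot_integral (2 * k + 1) = 2 ^ Suc (2 * k) *
      (\<Sum>l\<le>k. (-1) ^ l * ((pi / 2) ^ (2 * (k - l)) / fact (2 * (k - l))) * S1 l)"
    using cot_integral_eq_arcsin_series[of 0 k] by (simp add: S1_eq)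
  also have "\<dots> = (\<Sum>l\<le>k. (-1) ^ l *
      ((2 ^ Suc (2 * k) * (pi / 2) ^ (2 * (k - l))) / fact (2 * (k - l))) * S1 l)"
    unfolding sum_distrib_left by (intro sum.cong) (simp_all only: times_divide_eq_right mult_ac)
  also have "\<dots> = (\<Sum>l\<le>k. (-1) ^ l *
      (2 ^ (2 * l + 1) * pi ^ (2 * (k - l)) / fact (2 * (k - l))) * S1 l)"
    by (intro sum.cong refl) (simp only: pow atMost_iff)
  finally show "cot_integral (2 * k + 1) =
      (\<Sum>l=0..k. (-1) ^ l * (2 ^ (2 * l + 1) * pi ^ (2 * k - 2 * l) / fact (2 * k - 2 * l)) * S1 l)"
    by (simp only: atMost_atLeast0 diff_mult_distrib2)
  \<comment> \<open>The additional factor 2 joins \<open>arcsin_series 1 l\<close>; then 2^(2l+1) *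
    2 = 4^(l+1) is exactly the factor in \<open>S0_eq\<close>.\<close>
  have "cot_integral (2 * k + 2) = 2 * 2 ^ Suc (2 * k) *
      (\<Sum>l\<le>k. (-1) ^ l * ((pi / 2) ^ (2 * (k - l)) / fact (2 * (k - l) + 1)) * arcsin_series 1 l)"
    using cot_integral_eq_arcsin_series[of 1 k] by simp
  also have "\<dots> = (\<Sum>l\<le>k. (-1) ^ l *
      ((2 ^ Suc (2 * k) * (pi / 2) ^ (2 * (k - l))) / fact (2 * (k - l) + 1)) * (2 * arcsin_series 1 l))"
    unfolding sum_distrib_left by (intro sum.cong) (simp_all only: times_divide_eq_right mult_ac)
  also have "\<dots> = (\<Sum>l\<le>k. (-1) ^ l * (pi ^ (2 * (k - l)) / fact (2 * (k - l) + 1)) * S0 l)"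
  proof (intro sum.cong refl)
    fix l assume "l \<in> {..k}"
    then have l: "l \<le> k" by simp
    have S0: "S0 l = 2 ^ (2 * l + 1) * (2 * arcsin_series 1 l)"
      by (simp add: S0_eq power_mult)
    show "(-1) ^ l * ((2 ^ Suc (2 * k) * (pi / 2) ^ (2 * (k - l))) / fact (2 * (k - l) + 1)) *
        (2 * arcsin_series 1 l) = (-1) ^ l * (pi ^ (2 * (k - l)) / fact (2 * (k - l) + 1)) * S0 l"
      unfolding pow[OF l] S0
      by (simp only: times_divide_eq_left times_divide_eq_right mult_ac)
  qed
  finally show "cot_integral (2 * k + 2) =
      (\<Sum>l=0..k. (-1) ^ l * (pi ^ (2 * k - 2 * l) / fact (2 * k - 2 * l + 1)) * S0 l)"
    by (simp only: atMost_atLeast0 diff_mult_distrib2)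
qed

end
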